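(* Let $p>3$ be a prime with $p\equiv 3\pmod 4$, and let $b_n=\sum_{k=0}^{[n/3]}\binom{2k}k\binom{3k}k\binom n{3k}\binom{n+k}k(-3)^{n-3k}$ for $n\ge0$ (the Almkvist–Zudilin numbers). Then $$\sum_{n=0}^{p-1}\frac{b_n}{(-3)^n}\equiv \sum_{n=0}^{p-1}\frac{b_n}{(-27)^n}\equiv 0\pmod{p^2}.$$
   Context: $[x]$ denotes the greatest integer not exceeding $x$. Congruences are taken in the ring $\mathbb Z_p$ of rational numbers whose denominators are not divisible by $p$. *)

theory Defs
  imports Complex_Main "HOL-Computational_Algebra.Primes"
begin

text \<open>The ring \<open>\<int>\<^sub>p\<close> of rational numbers whose denominators (in lowest terms) are not divisible by \<open>p\<close>.\<close>

definition p_integral :: "nat \<Rightarrow> rat set" where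
  "p_integral p = {x. \<not> int p dvd snd (quotient_of x)}"

text \<open>\<open>a \<equiv> b (mod m)\<close> in \<open>\<int>\<^sub>p\<close>: both sides lie in \<open>\<int>\<^sub>p\<close> and their difference lies in the
  ideal \<open>m \<int>\<^sub>p\<close>.\<close>

definition p_integral_cong :: "nat \<Rightarrow> rat \<Rightarrow> rat \<Rightarrow> nat \<Rightarrow> bool" where
  "p_integral_cong p a b m \<longleftrightarrow>
     a \<in> p_integral p \<and> b \<in> p_integral p \<and> (\<exists>c\<in>p_integral p. a - b = of_nat m * c)"

text \<open>The Almkvist--Zudilin numbers. In the range of summation \<open>3 * k \<le> n\<close>, so the natural-number
  subtraction in the exponent does not truncate.\<close>

definition almkvist_zudilin :: "nat \<Rightarrow> int" where
  "almkvist_zudilin n =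
     (\<Sum>k = 0..n div 3.
        int ((2 * k) choose k) * int ((3 * k) choose k) * int (n choose (3 * k)) *
        int ((n + k) choose k) * (-3) ^ (n - 3 * k))"

end

theory Submission
  imports Defs "HOL-Number_Theory.Cong"
begin

text \<open>Put \<open>w k = (4k)! / k!^4 / (-27)^k\<close>. Then
  \<open>b n / (-3)^n = (\<Sum>k. w k * (n+k choose 4k))\<close> directly from the definition, and
  \<open>b n / (-27)^n = (\<Sum>k. w k * (n+3k choose 4k))\<close> because, by creative telescoping, both sums
  lead to solutions of the same three-term recurrence. Summing over \<open>n < p\<close> turns the binomials into
  \<open>(p+k choose 4k+1)\<close> and \<open>(p+3k choose 4k+1)\<close>. Each of these carries a factor \<open>p\<close>, and modulo
  \<open>p^2\<close> both totals reduce to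
  \<open>p * (\<Sum>k\<le>p/3. (3k)! / (k!^3 * 27^k * (4k+1)))\<close>: the denominator \<open>4k+1\<close> is divisible by \<open>p\<close> only
  if \<open>4k+1 = 3p\<close>, and then the numerator has the further factors \<open>2p\<close> and \<open>3p\<close>. With
  \<open>m = \<lfloor>p/3\<rfloor>\<close> one has \<open>(3k)! / (k!^3 * 27^k) \<equiv> (-1)^k (m choose k) (m+k choose k)\<close> modulo \<open>p\<close>, and
  \<open>\<Sum>k\<le>m. (-1)^k (m choose k) (m+k choose k) / (4k+1)\<close> is the quotient of
  \<open>\<Prod>j=1..m. 4j-1\<close> by \<open>\<Prod>j\<le>m. 4j+1\<close>, whose numerator contains the factor \<open>p = 4j-1\<close>
  with \<open>j = (p+1)/4\<close>.\<close>

subsection \<open>Two expansions of the Almkvist--Zudilin numbers\<close>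

definition quartic_weight :: "nat \<Rightarrow> rat" where
  "quartic_weight k = fact (4 * k) / fact k ^ 4 / (-27) ^ k"

lemma quartic_weight_0 [simp]: "quartic_weight 0 = 1"
  by (simp add: quartic_weight_def)

lemma quartic_weight_Suc:
  "quartic_weight k * ((4 * of_nat k + 4) * (4 * of_nat k + 3) * (4 * of_nat k + 2) * (4 * of_nat k + 1))
     = - 27 * (of_nat k + 1) ^ 4 * quartic_weight (Suc k)"
proof -
  have "fact (4 * Suc k) = (fact (4 * k) :: rat) *
      ((4 * of_nat k + 4) * (4 * of_nat k + 3) * (4 * of_nat k + 2) * (4 * of_nat k + 1))"
    by (simp add: fact_reduce numeral_eq_Suc algebra_simps)
  moreover have "fact (Suc k) = (of_nat k + 1) * (fact k :: rat)"
    by (simp add: algebra_simps)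
  moreover have "(of_nat k + 1 :: rat) \<noteq> 0"
    by (metis of_nat_Suc of_nat_neq_0 add.commute)
  ultimately show ?thesis
    unfolding quartic_weight_def by (simp add: power_mult_distrib del: fact_Suc)
qed

section \<open>Binomial ratios and creative telescoping\<close>

lemma binomial_absorption_rat:
  "of_nat (Suc a choose Suc r) * (of_nat r + 1 :: rat) = (of_nat a + 1) * of_nat (a choose r)"
  using arg_cong[OF Suc_times_binomial[of r a], of "of_nat :: nat \<Rightarrow> rat"]
  by (simp add: algebra_simps)

lemma binomial_absorb_comp_rat:
  "of_nat (a choose Suc r) * (of_nat r + 1 :: rat) = (of_nat a - of_nat r) * of_nat (a choose r)"
proof -
  have "of_nat (Suc a choose Suc r) * (of_nat r + 1 :: rat)
      = of_nat (a choose r) * (of_nat r + 1) + of_nat (a choose Suc r) * (of_nat r + 1)"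
    by (simp add: algebra_simps)
  then show ?thesis
    unfolding binomial_absorption_rat by (simp add: algebra_simps)
qed

lemma eq_of_mult_eq:
  fixes a b c d :: "'a :: idom"
  shows "a * c = b \<Longrightarrow> c \<noteq> 0 \<Longrightarrow> b = d * c \<Longrightarrow> a = d"
  by simp

text \<open>The right-hand side is the Zeilberger certificate: it is the \<open>(K+1)\<close>-st value \<open>G (K + 1)\<close> of
  Gosper's antidifference \<open>G k = - 108 * (4x+5) * k^4 * (n+k)! / (k!^4 * (n+2-3k)!) / (-27)^k\<close>,
  rewritten with \<open>w K\<close> so that no factorial of a truncated difference occurs.\<close>

lemma az_telescope_minus3:
  fixes n :: nat
  defines "x \<equiv> of_nat n :: rat"
  shows "(\<Sum>k\<le>K. quartic_weight k *
            (3 * (x + 2) ^ 3 * of_nat (n + 2 + k choose (4 * k))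
             - (2 * x + 3) * (7 * (x + 1) ^ 2 + 7 * (x + 1) + 3) * of_nat (n + 1 + k choose (4 * k))
             + 27 * (x + 1) ^ 3 * of_nat (n + k choose (4 * k))))
       = 4 * (4 * x + 5) * (4 * of_nat K + 2) * (4 * of_nat K + 1) * quartic_weight K
           * of_nat (n + K + 1 choose (4 * K + 2))"
proof (induction K)
  case 0
  have "of_nat (Suc n choose Suc (Suc 0)) = (x + 1) * x / 2"
    using binomial_absorption_rat[of n 1] by (simp add: x_def del: binomial_Suc_Suc)
  then have base: "of_nat (n + 0 + 1 choose (4 * 0 + 2)) = (x + 1) * x / 2"
    by (simp add: eval_nat_numeral del: binomial_Suc_Suc)
  \<comment> \<open>At k = 0 all three binomials and the weight are 1, so the summand is this bare
    polynomial.\<close>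
  have "3 * (x + 2) ^ 3 - (2 * x + 3) * (7 * (x + 1) ^ 2 + 7 * (x + 1) + 3)
      + 27 * (x + 1) ^ 3 = 4 * (4 * x + 5) * ((x + 1) * x)" by algebra
  also have "\<dots> = 4 * (4 * x + 5) * 2 * ((x + 1) * x / 2)" by simp
  also have "(x + 1) * x / 2 = of_nat (n + 0 + 1 choose (4 * 0 + 2))"
    by (rule base[symmetric])
  finally show ?case by simp
next
  case (Suc K)
  define a where "a = n + K + 1"
  define r where "r = 4 * K + 2"
  define y where "y = (of_nat K :: rat)"
  \<comment> \<open>Dividing out the denominators r + 1 and r + 2 makes every binomial of the new
    summand a polynomial multiple of \<open>v\<close>, so no division remains.\<close>
  define v where "v = (of_nat (a choose r) :: rat) / ((4 * y + 3) * (4 * y + 4))"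
  have y: "y \<ge> 0" by (simp add: y_def)
  have a: "of_nat a = x + y + 1" and r: "of_nat r = 4 * y + 2"
    by (simp_all add: a_def r_def x_def y_def)
  have b0: "of_nat (a choose r) = v * (4 * y + 3) * (4 * y + 4)"
    using y by (simp add: v_def)
  have b1: "of_nat (a choose Suc r) = v * (4 * y + 4) * (x - 3 * y - 1)"
    by (rule eq_of_mult_eq[OF binomial_absorb_comp_rat[of a r]])
      (use y in \<open>simp_all add: a r b0 algebra_simps del: binomial_Suc_Suc\<close>)
  have b2: "of_nat (a choose Suc (Suc r)) = v * (x - 3 * y - 1) * (x - 3 * y - 2)"
    by (rule eq_of_mult_eq[OF binomial_absorb_comp_rat[of a "Suc r"]])
      (use y in \<open>simp_all add: a r b1 algebra_simps del: binomial_Suc_Suc\<close>)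
  have b3: "of_nat (a choose Suc (Suc (Suc r))) * (4 * y + 5)
      = v * (x - 3 * y - 1) * (x - 3 * y - 2) * (x - 3 * y - 3)"
    using binomial_absorb_comp_rat[of a "Suc (Suc r)"] unfolding a r b2 of_nat_Suc
    by (simp add: algebra_simps)
  have c1: "of_nat (Suc a choose Suc r) = v * (4 * y + 4) * (x + y + 2)"
    by (rule eq_of_mult_eq[OF binomial_absorption_rat[of a r]])
      (use y in \<open>simp_all add: a r b0 algebra_simps del: binomial_Suc_Suc\<close>)
  have c2: "of_nat (Suc a choose Suc (Suc r)) = v * (x - 3 * y - 1) * (x + y + 2)"
    by (rule eq_of_mult_eq[OF binomial_absorption_rat[of a "Suc r"]])
      (use y in \<open>simp_all add: a r b1 algebra_simps del: binomial_Suc_Suc\<close>)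
  have d2: "of_nat (Suc (Suc a) choose Suc (Suc r)) = v * (x + y + 2) * (x + y + 3)"
    by (rule eq_of_mult_eq[OF binomial_absorption_rat[of "Suc a" "Suc r"]])
      (use y in \<open>simp_all add: a r c1 algebra_simps del: binomial_Suc_Suc\<close>)
  have c4: "(4 * y + 6) * (4 * y + 5) * of_nat (Suc a choose Suc (Suc (Suc (Suc r))))
      = v * (x + y + 2) * (x - 3 * y - 1) * (x - 3 * y - 2) * (x - 3 * y - 3)"
  proof -
    have "of_nat (Suc a choose Suc (Suc (Suc (Suc r)))) * (4 * y + 6)
        = (x + y + 2) * of_nat (a choose Suc (Suc (Suc r)))"
      using binomial_absorption_rat[of a "Suc (Suc (Suc r))"] unfolding a r of_nat_Suc
      by (simp add: add.commute add.left_commute del: binomial_Suc_Suc)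
    then have "(4 * y + 6) * (4 * y + 5) * of_nat (Suc a choose Suc (Suc (Suc (Suc r))))
        = (x + y + 2) * (of_nat (a choose Suc (Suc (Suc r))) * (4 * y + 5))"
      by (metis mult.assoc mult.commute)
    then show ?thesis unfolding b3 by (simp only: mult_ac)
  qed
  have w: "quartic_weight K * ((4 * y + 4) * (4 * y + 3) * (4 * y + 2) * (4 * y + 1))
     = - 27 * (y + 1) ^ 4 * quartic_weight (Suc K)"
    unfolding y_def by (rule quartic_weight_Suc)
  have idx: "n + 2 + Suc K = Suc (Suc a)" "n + 1 + Suc K = Suc a" "n + Suc K = a"
    "n + K + 1 = a" "a + 1 = Suc a"
    "4 * Suc K = Suc (Suc r)" "4 * K + 2 = r" "Suc (Suc r) + 2 = Suc (Suc (Suc (Suc r)))"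
    by (simp_all add: a_def r_def)
  have y': "of_nat K = y" "of_nat (Suc K) = y + 1" by (simp_all add: y_def)
  let ?f = "4 * (4 * x + 5)" and ?w = "quartic_weight (Suc K)"
  let ?P = "3 * (x + 2) ^ 3 * (v * (x + y + 2) * (x + y + 3))
     - (2 * x + 3) * (7 * (x + 1) ^ 2 + 7 * (x + 1) + 3) * (v * (x - 3 * y - 1) * (x + y + 2))
     + 27 * (x + 1) ^ 3 * (v * (x - 3 * y - 1) * (x - 3 * y - 2))"
  \<comment> \<open>The certificate at K is first expressed by the weight at K + 1. The next
    equality is then a polynomial identity in x and y, and \<open>c4\<close> recognizes the result
    as the certificate at K + 1.\<close>
  have "?f * (4 * y + 2) * (4 * y + 1) * quartic_weight K * (v * (4 * y + 3) * (4 * y + 4)) + ?w * ?P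
      = ?f * v * (- 27 * (y + 1) ^ 4 * ?w) + ?w * ?P"
    unfolding w[symmetric] by algebra
  also have "\<dots> = ?f * ?w * (v * (x + y + 2) * (x - 3 * y - 1) * (x - 3 * y - 2) * (x - 3 * y - 3))"
    by algebra
  also have "\<dots> = ?f * (4 * (y + 1) + 2) * (4 * (y + 1) + 1) * ?w
      * of_nat (Suc a choose Suc (Suc (Suc (Suc r))))"
    unfolding c4[symmetric] by algebra
  finally show ?case
    unfolding sum.atMost_Suc Suc.IH idx y' b0 b2 c2 d2 .
qed

text \<open>Here the antidifference is \<open>G k = - 108 * (4x+7) * k^4 * (n+3k)! / (k!^4 *
  (n+2-k)!) / (-27)^k\<close>, and the right-hand side is again \<open>G (K + 1)\<close>. Compared
  with the other telescoping, the outer coefficients 3 and 27 are interchanged; rescaling by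
  \<open>9 ^ n\<close> undoes this later.\<close>

lemma az_telescope_minus27:
  fixes n :: nat
  defines "x \<equiv> of_nat n :: rat"
  shows "(\<Sum>k\<le>K. quartic_weight k *
            (27 * (x + 2) ^ 3 * of_nat (n + 2 + 3 * k choose (4 * k))
             - (2 * x + 3) * (7 * (x + 1) ^ 2 + 7 * (x + 1) + 3) * of_nat (n + 1 + 3 * k choose (4 * k))
             + 3 * (x + 1) ^ 3 * of_nat (n + 3 * k choose (4 * k))))
       = 4 * (4 * x + 7) * (4 * of_nat K + 2) * (4 * of_nat K + 1) * quartic_weight K
           * of_nat (n + 3 * K + 3 choose (4 * K + 2))"
proof (induction K)
  case 0
  have "of_nat (Suc (n + 2) choose Suc (Suc 0)) = (x + 3) * (x + 2) / 2"
    using binomial_absorption_rat[of "n + 2" 1]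
    by (simp add: x_def algebra_simps del: binomial_Suc_Suc)
  then have base: "of_nat (n + 3 * 0 + 3 choose (4 * 0 + 2)) = (x + 3) * (x + 2) / 2"
    by (simp add: eval_nat_numeral del: binomial_Suc_Suc)
  have "27 * (x + 2) ^ 3 - (2 * x + 3) * (7 * (x + 1) ^ 2 + 7 * (x + 1) + 3)
      + 3 * (x + 1) ^ 3 = 4 * (4 * x + 7) * ((x + 3) * (x + 2))" by algebra
  also have "\<dots> = 4 * (4 * x + 7) * 2 * ((x + 3) * (x + 2) / 2)" by (simp add: field_simps)
  also have "(x + 3) * (x + 2) / 2 = of_nat (n + 3 * 0 + 3 choose (4 * 0 + 2))"
    by (rule base[symmetric])
  finally show ?case by simp
next
  case (Suc K)
  define a where "a = n + 3 * K + 3"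
  define r where "r = 4 * K + 2"
  define y where "y = (of_nat K :: rat)"
  define v where "v = (of_nat (a choose r) :: rat) / ((4 * y + 3) * (4 * y + 4))"
  have y: "y \<ge> 0" by (simp add: y_def)
  have a: "of_nat a = x + 3 * y + 3" and r: "of_nat r = 4 * y + 2"
    by (simp_all add: a_def r_def x_def y_def)
  have b0: "of_nat (a choose r) = v * (4 * y + 3) * (4 * y + 4)"
    using y by (simp add: v_def)
  have b1: "of_nat (a choose Suc r) = v * (4 * y + 4) * (x - y + 1)"
    by (rule eq_of_mult_eq[OF binomial_absorb_comp_rat[of a r]])
      (use y in \<open>simp_all add: a r b0 algebra_simps del: binomial_Suc_Suc\<close>)
  have b2: "of_nat (a choose Suc (Suc r)) = v * (x - y + 1) * (x - y)"
    by (rule eq_of_mult_eq[OF binomial_absorb_comp_rat[of a "Suc r"]])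
      (use y in \<open>simp_all add: a r b1 algebra_simps del: binomial_Suc_Suc\<close>)
  have c1: "of_nat (Suc a choose Suc r) = v * (4 * y + 4) * (x + 3 * y + 4)"
    by (rule eq_of_mult_eq[OF binomial_absorption_rat[of a r]])
      (use y in \<open>simp_all add: a r b0 algebra_simps del: binomial_Suc_Suc\<close>)
  have c2: "of_nat (Suc a choose Suc (Suc r)) = v * (x - y + 1) * (x + 3 * y + 4)"
    by (rule eq_of_mult_eq[OF binomial_absorption_rat[of a "Suc r"]])
      (use y in \<open>simp_all add: a r b1 algebra_simps del: binomial_Suc_Suc\<close>)
  have d2: "of_nat (Suc (Suc a) choose Suc (Suc r)) = v * (x + 3 * y + 4) * (x + 3 * y + 5)"
    by (rule eq_of_mult_eq[OF binomial_absorption_rat[of "Suc a" "Suc r"]])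
      (use y in \<open>simp_all add: a r c1 algebra_simps del: binomial_Suc_Suc\<close>)
  \<comment> \<open>This certificate moves diagonally: two absorptions lead from a + 1 over r + 2 to
    a + 3 over r + 4.\<close>
  have e4: "(4 * y + 6) * (4 * y + 5) * of_nat (Suc (Suc (Suc a)) choose Suc (Suc (Suc (Suc r))))
      = v * (x - y + 1) * (x + 3 * y + 4) * (x + 3 * y + 5) * (x + 3 * y + 6)"
  proof -
    have "of_nat (Suc (Suc (Suc a)) choose Suc (Suc (Suc (Suc r)))) * (4 * y + 6)
        = (x + 3 * y + 6) * of_nat (Suc (Suc a) choose Suc (Suc (Suc r)))"
      using binomial_absorption_rat[of "Suc (Suc a)" "Suc (Suc (Suc r))"] unfolding a r of_nat_Suc
      by (simp add: add.commute add.left_commute del: binomial_Suc_Suc)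
    then have "(4 * y + 6) * (4 * y + 5) * of_nat (Suc (Suc (Suc a)) choose Suc (Suc (Suc (Suc r))))
        = (x + 3 * y + 6) * (of_nat (Suc (Suc a) choose Suc (Suc (Suc r))) * (4 * y + 5))"
      by (metis mult.assoc mult.commute)
    also have "of_nat (Suc (Suc a) choose Suc (Suc (Suc r))) * (4 * y + 5)
        = (x + 3 * y + 5) * (v * (x - y + 1) * (x + 3 * y + 4))"
      using binomial_absorption_rat[of "Suc a" "Suc (Suc r)"] unfolding a r c2 of_nat_Suc
      by (simp add: add.commute add.left_commute del: binomial_Suc_Suc)
    finally show ?thesis by (simp only: mult_ac)
  qed
  have w: "quartic_weight K * ((4 * y + 4) * (4 * y + 3) * (4 * y + 2) * (4 * y + 1))
     = - 27 * (y + 1) ^ 4 * quartic_weight (Suc K)"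
    unfolding y_def by (rule quartic_weight_Suc)
  have idx: "n + 2 + 3 * Suc K = Suc (Suc a)" "n + 1 + 3 * Suc K = Suc a" "n + 3 * Suc K = a"
    "n + 3 * K + 3 = a" "a + 3 = Suc (Suc (Suc a))"
    "4 * Suc K = Suc (Suc r)" "4 * K + 2 = r" "Suc (Suc r) + 2 = Suc (Suc (Suc (Suc r)))"
    by (simp_all add: a_def r_def)
  have y': "of_nat K = y" "of_nat (Suc K) = y + 1" by (simp_all add: y_def)
  let ?f = "4 * (4 * x + 7)" and ?w = "quartic_weight (Suc K)"
  let ?P = "27 * (x + 2) ^ 3 * (v * (x + 3 * y + 4) * (x + 3 * y + 5))
     - (2 * x + 3) * (7 * (x + 1) ^ 2 + 7 * (x + 1) + 3) * (v * (x - y + 1) * (x + 3 * y + 4))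
     + 3 * (x + 1) ^ 3 * (v * (x - y + 1) * (x - y))"
  have "?f * (4 * y + 2) * (4 * y + 1) * quartic_weight K * (v * (4 * y + 3) * (4 * y + 4)) + ?w * ?P
      = ?f * v * (- 27 * (y + 1) ^ 4 * ?w) + ?w * ?P"
    unfolding w[symmetric] by algebra
  also have "\<dots> = ?f * ?w * (v * (x - y + 1) * (x + 3 * y + 4) * (x + 3 * y + 5) * (x + 3 * y + 6))"
    by algebra
  also have "\<dots> = ?f * (4 * (y + 1) + 2) * (4 * (y + 1) + 1) * ?w
      * of_nat (a + 3 choose Suc (Suc (Suc (Suc r))))"
    unfolding idx e4[symmetric] by algebra
  finally show ?case
    unfolding sum.atMost_Suc Suc.IH idx y' b0 b2 c2 d2 .
qed

section \<open>The common recurrence and the identification of the two sequences\<close>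

lemma three_term_recurrence_unique:
  fixes f g :: "nat \<Rightarrow> 'a :: field"
  assumes f: "\<And>n. A n * f (n + 2) - B n * f (n + 1) + C n * f n = 0"
    and g: "\<And>n. A n * g (n + 2) - B n * g (n + 1) + C n * g n = 0"
    and A: "\<And>n. A n \<noteq> 0"
    and init: "f 0 = g 0" "f 1 = g 1"
  shows "f n = g n"
proof (induction n rule: induct_nat_012)
  case (ge2 n)
  then have "g n = f n" "g (n + 1) = f (n + 1)" by simp_all
  then have "A n * f (n + 2) - B n * f (n + 1) + C n * f n
      = A n * g (n + 2) - B n * f (n + 1) + C n * f n"
    using f[of n] g[of n] by simp
  then show ?case using A[of n] by simp
qed (use init in simp_all)

text \<open>This will turn out to be b_n / (-3)^n. The terms with 3k > n vanish, so the upper limit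
  n may replace n div 3.\<close>

definition az_minus3 :: "nat \<Rightarrow> rat" where
  "az_minus3 n = (\<Sum>k\<le>n. quartic_weight k * of_nat (n + k choose (4 * k)))"

definition az_minus27 :: "nat \<Rightarrow> rat" where
  "az_minus27 n = (\<Sum>k\<le>n. quartic_weight k * of_nat (n + 3 * k choose (4 * k)))"

text \<open>Terms beyond n vanish. A common range for several values of n is what the recurrence and
  the interchange of summations need.\<close>

lemma az_minus3_extend:
  assumes "n \<le> N"
  shows "az_minus3 n = (\<Sum>k\<le>N. quartic_weight k * of_nat (n + k choose (4 * k)))"
  unfolding az_minus3_def
  by (rule sum.mono_neutral_left) (use assms in \<open>auto simp: binomial_eq_0\<close>)

lemma az_minus27_extend:
  assumes "n \<le> N"
  shows "az_minus27 n = (\<Sum>k\<le>N. quartic_weight k * of_nat (n + 3 * k choose (4 * k)))"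
  unfolding az_minus27_def
  by (rule sum.mono_neutral_left) (use assms in \<open>auto simp: binomial_eq_0\<close>)

lemma az_minus3_recurrence:
  fixes n :: nat
  defines "x \<equiv> of_nat n :: rat"
  shows "3 * (x + 2) ^ 3 * az_minus3 (n + 2)
     - (2 * x + 3) * (7 * (x + 1) ^ 2 + 7 * (x + 1) + 3) * az_minus3 (n + 1)
     + 27 * (x + 1) ^ 3 * az_minus3 n = 0" (is "?A * _ - ?B * _ + ?C * _ = 0")
proof -
  let ?T = "\<lambda>i k. quartic_weight k * of_nat (n + i + k choose (4 * k))"
  have ext: "az_minus3 (n + i) = (\<Sum>k\<le>n + 2. ?T i k)" if "i \<le> 2" for i
    using that by (intro az_minus3_extend) simp
  have "?A * az_minus3 (n + 2) - ?B * az_minus3 (n + 1) + ?C * az_minus3 (n + 0)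
      = (\<Sum>k\<le>n + 2. ?A * ?T 2 k - ?B * ?T 1 k + ?C * ?T 0 k)"
    by (simp only: ext[of 2] ext[of 1] ext[of 0] sum_distrib_left sum.distrib sum_subtractf
        order_refl zero_le one_le_numeral)
  \<comment> \<open>For K = n + 2 the certificate contains the binomial 2n + 3 over 4n + 10, which
    is zero.\<close>
  also have "\<dots> = 0"
    using az_telescope_minus3[of n "n + 2"]
    by (simp add: x_def[symmetric] algebra_simps binomial_eq_0 del: binomial_Suc_Suc sum.atMost_Suc)
  finally show ?thesis by simp
qed

lemma az_minus27_recurrence:
  fixes n :: nat
  defines "x \<equiv> of_nat n :: rat"
  shows "27 * (x + 2) ^ 3 * az_minus27 (n + 2)
     - (2 * x + 3) * (7 * (x + 1) ^ 2 + 7 * (x + 1) + 3) * az_minus27 (n + 1)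
     + 3 * (x + 1) ^ 3 * az_minus27 n = 0" (is "?A * _ - ?B * _ + ?C * _ = 0")
proof -
  let ?T = "\<lambda>i k. quartic_weight k * of_nat (n + i + 3 * k choose (4 * k))"
  have ext: "az_minus27 (n + i) = (\<Sum>k\<le>n + 2. ?T i k)" if "i \<le> 2" for i
    using that by (intro az_minus27_extend) simp
  have "?A * az_minus27 (n + 2) - ?B * az_minus27 (n + 1) + ?C * az_minus27 (n + 0)
      = (\<Sum>k\<le>n + 2. ?A * ?T 2 k - ?B * ?T 1 k + ?C * ?T 0 k)"
    by (simp only: ext[of 2] ext[of 1] ext[of 0] sum_distrib_left sum.distrib sum_subtractf
        order_refl zero_le one_le_numeral)
  \<comment> \<open>For K = n + 2 the certificate contains the binomial 4n + 9 over 4n + 10, which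
    is zero by a margin of one.\<close>
  also have "\<dots> = 0"
    using az_telescope_minus27[of n "n + 2"]
    by (simp add: x_def[symmetric] algebra_simps binomial_eq_0 del: binomial_Suc_Suc sum.atMost_Suc)
  finally show ?thesis by simp
qed

text \<open>Multiplying the recurrence of \<open>az_minus27\<close> by \<open>9 ^ (n + 1)\<close>
  turns its outer coefficients 27 and 3 into 3 and 27 for the rescaled sequence, which is the
  recurrence of \<open>az_minus3\<close>. At n = 0 and n = 1 both sequences have the value
  1.\<close>

lemma az_minus3_eq_az_minus27: "az_minus3 n = 9 ^ n * az_minus27 n"
proof (rule three_term_recurrence_unique)
  fix n :: nat
  show "3 * (of_nat n + 2) ^ 3 * az_minus3 (n + 2)
     - (2 * of_nat n + 3) * (7 * (of_nat n + 1) ^ 2 + 7 * (of_nat n + 1) + 3) * az_minus3 (n + 1)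
     + 27 * (of_nat n + 1) ^ 3 * az_minus3 n = 0"
    by (rule az_minus3_recurrence)
  show "3 * (of_nat n + 2) ^ 3 * (9 ^ (n + 2) * az_minus27 (n + 2))
     - (2 * of_nat n + 3) * (7 * (of_nat n + 1) ^ 2 + 7 * (of_nat n + 1) + 3)
         * (9 ^ (n + 1) * az_minus27 (n + 1))
     + 27 * (of_nat n + 1) ^ 3 * (9 ^ n * az_minus27 n) = 0"
    using arg_cong[OF az_minus27_recurrence[of n], of "\<lambda>t. 9 * 9 ^ n * t"]
    by (simp add: algebra_simps power2_eq_square)
  show "3 * (of_nat n + 2 :: rat) ^ 3 \<noteq> 0"
    by (metis mult_eq_0_iff of_nat_Suc of_nat_add of_nat_eq_0_iff of_nat_numeral add_is_0
        power_not_zero zero_neq_numeral)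
qed (simp_all add: az_minus3_def az_minus27_def quartic_weight_def eval_nat_numeral)

text \<open>Termwise: the four binomials multiply to (n+k)! / (k!^4 (n-3k)!), which is (4k)! / k!^4
  times the binomial n + k over 4k, and the powers of -3 leave (-27)^(-k).\<close>

lemma almkvist_zudilin_conv_az_minus3:
  "of_int (almkvist_zudilin n) / (-3) ^ n = az_minus3 n"
proof -
  have term_eq: "of_int (int ((2 * k) choose k) * int ((3 * k) choose k) * int (n choose (3 * k)) *
        int ((n + k) choose k) * (-3) ^ (n - 3 * k)) / (-3) ^ n
      = quartic_weight k * of_nat (n + k choose (4 * k))" if k: "3 * k \<le> n" for k
  proof -
    have "(-3 :: rat) ^ n = (-3) ^ (n - 3 * k) * (-27) ^ k"
      using k power_mult[of "-3 :: rat" 3 k] power_add[of "-3 :: rat" "n - 3 * k" "3 * k"] by simp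
    then show ?thesis
      using k by (simp add: quartic_weight_def binomial_fact power4_eq_xxxx)
  qed
  have "of_int (almkvist_zudilin n) / (-3) ^ n
      = (\<Sum>k = 0..n div 3. quartic_weight k * of_nat (n + k choose (4 * k)))"
    unfolding almkvist_zudilin_def of_int_sum sum_divide_distrib
    by (intro sum.cong refl term_eq) simp
  also have "\<dots> = az_minus3 n"
    unfolding az_minus3_def
    by (rule sum.mono_neutral_left) (auto simp: binomial_eq_0 div_less_iff_less_mult)
  finally show ?thesis .
qed

lemma almkvist_zudilin_conv_az_minus27:
  "of_int (almkvist_zudilin n) / (-27) ^ n = az_minus27 n"
proof -
  have "(-27 :: rat) ^ n = 9 ^ n * (-3) ^ n" by (simp flip: power_mult_distrib)
  then show ?thesis
    using almkvist_zudilin_conv_az_minus3[of n] az_minus3_eq_az_minus27[of n]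
    by (simp add: field_simps)
qed

section \<open>Summation over n < p\<close>

lemma sum_binomial_shift:
  assumes "i \<le> r"
  shows "(\<Sum>n<p. n + i choose r) = p + i choose (r + 1)"
  \<comment> \<open>Hockey-stick summation; the boundary term \<open>i choose (r + 1)\<close> at p =
    0 vanishes because i \<le> r.\<close>
  using assms by (induction p) (simp_all add: binomial_eq_0)

lemma sum_az_minus3:
  "(\<Sum>n<p. az_minus3 n) = (\<Sum>k<p. quartic_weight k * of_nat (p + k choose (4 * k + 1)))"
proof -
  \<comment> \<open>The guard supplies p > 0; for p = 0 truncated subtraction would leave the
    nonempty set {..0}.\<close>
  have "{..p - 1} = {..<p}" if "n < p" for n using that by auto
  then have "(\<Sum>n<p. az_minus3 n)
      = (\<Sum>n<p. \<Sum>k<p. quartic_weight k * of_nat (n + k choose (4 * k)))"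
    by (intro sum.cong refl) (simp add: az_minus3_extend[of _ "p - 1"])
  also have "\<dots> = (\<Sum>k<p. \<Sum>n<p. quartic_weight k * of_nat (n + k choose (4 * k)))"
    by (rule sum.swap)
  also have "\<dots> = (\<Sum>k<p. quartic_weight k * of_nat (p + k choose (4 * k + 1)))"
  proof (intro sum.cong refl)
    fix k
    show "(\<Sum>n<p. quartic_weight k * of_nat (n + k choose (4 * k)))
        = quartic_weight k * of_nat (p + k choose (4 * k + 1))"
      by (simp flip: sum_distrib_left of_nat_sum add: sum_binomial_shift)
  qed
  finally show ?thesis .
qed

lemma sum_az_minus27:
  "(\<Sum>n<p. az_minus27 n) = (\<Sum>k<p. quartic_weight k * of_nat (p + 3 * k choose (4 * k + 1)))"
proof -
  have "{..p - 1} = {..<p}" if "n < p" for n using that by auto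
  then have "(\<Sum>n<p. az_minus27 n)
      = (\<Sum>n<p. \<Sum>k<p. quartic_weight k * of_nat (n + 3 * k choose (4 * k)))"
    by (intro sum.cong refl) (simp add: az_minus27_extend[of _ "p - 1"])
  also have "\<dots> = (\<Sum>k<p. \<Sum>n<p. quartic_weight k * of_nat (n + 3 * k choose (4 * k)))"
    by (rule sum.swap)
  also have "\<dots> = (\<Sum>k<p. quartic_weight k * of_nat (p + 3 * k choose (4 * k + 1)))"
  proof (intro sum.cong refl)
    fix k
    show "(\<Sum>n<p. quartic_weight k * of_nat (n + 3 * k choose (4 * k)))
        = quartic_weight k * of_nat (p + 3 * k choose (4 * k + 1))"
      by (simp flip: sum_distrib_left of_nat_sum add: sum_binomial_shift)
  qed
  finally show ?thesis .
qed


subsection \<open>Coefficients of shifted Legendre polynomials\<close>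

text \<open>The coefficient of x^k in the Legendre polynomial P_m(1 - 2x).\<close>

definition legendre_coeff :: "nat \<Rightarrow> nat \<Rightarrow> rat" where
  "legendre_coeff m k = (-1) ^ k * of_nat (m choose k) * of_nat (m + k choose k)"

lemma legendre_coeff_0 [simp]: "legendre_coeff m 0 = 1"
  by (simp add: legendre_coeff_def)

lemma legendre_coeff_Suc_right:
  "legendre_coeff m (Suc k) * (of_nat k + 1) ^ 2
     = - (of_nat m - of_nat k) * (of_nat m + of_nat k + 1) * legendre_coeff m k"
proof -
  have "legendre_coeff m (Suc k) * (of_nat k + 1) ^ 2
      = - ((-1) ^ k) * (of_nat (m choose Suc k) * (of_nat k + 1))
          * (of_nat (Suc (m + k) choose Suc k) * (of_nat k + 1))"
    by (simp add: legendre_coeff_def power2_eq_square mult_ac del: binomial_Suc_Suc)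
  then show ?thesis
    unfolding binomial_absorption_rat[of "m + k"] binomial_absorb_comp_rat[of m]
    by (simp add: legendre_coeff_def algebra_simps del: binomial_Suc_Suc)
qed

text \<open>The mixed product \<open>t\<close> makes the coefficients of degrees m and m + 1 linear
  multiples of one quantity, so that a combination of them can be factored.\<close>

lemma legendre_coeff_Suc_left:
  fixes m k :: nat
  defines "t \<equiv> (-1) ^ k * of_nat (Suc m choose k) * of_nat (m + k choose k) :: rat"
  shows "legendre_coeff (Suc m) k * (of_nat m + 1) = (of_nat m + 1 + of_nat k) * t"
    and "legendre_coeff m k * (of_nat m + 1) = (of_nat m + 1 - of_nat k) * t"
proof -
  have step: "of_nat (Suc n choose k) * (of_nat n + 1 - of_nat k)
      = (of_nat n + 1) * (of_nat (n choose k) :: rat)" for n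
  proof (cases k)
    case (Suc j)
    then show ?thesis
      using binomial_absorption_rat[of n j] binomial_absorb_comp_rat[of n j]
      by (simp add: algebra_simps)
  qed simp
  have "of_nat (Suc m + k choose k) * (of_nat m + 1)
      = (of_nat m + 1 + of_nat k) * (of_nat (m + k choose k) :: rat)"
    using step[of "m + k"] by (simp add: algebra_simps del: binomial_Suc_Suc)
  then have "legendre_coeff (Suc m) k * (of_nat m + 1) = (-1) ^ k * of_nat (Suc m choose k)
      * ((of_nat m + 1 + of_nat k) * (of_nat (m + k choose k) :: rat))"
    unfolding legendre_coeff_def by (metis mult.assoc)
  then show "legendre_coeff (Suc m) k * (of_nat m + 1) = (of_nat m + 1 + of_nat k) * t"
    unfolding t_def by (simp only: mult_ac)
  have "legendre_coeff m k * (of_nat m + 1)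
      = (-1) ^ k * ((of_nat m + 1) * of_nat (m choose k)) * of_nat (m + k choose k)"
    unfolding legendre_coeff_def by (simp only: mult_ac)
  then show "legendre_coeff m k * (of_nat m + 1) = (of_nat m + 1 - of_nat k) * t"
    unfolding step[symmetric] t_def by (simp only: mult_ac)
qed

text \<open>Successive terms have the ratio -((m+1)^2 - K^2) / (K+1)^2, so the partial sums
  telescope. The closed form is wanted at K = m + 1, where it vanishes.\<close>

lemma sum_alternating_binomial_product:
  "(\<Sum>k\<le>K. (-1) ^ k * of_nat (Suc m choose k) * of_nat (m + k choose k)) * (of_nat m + 1) ^ 2
     = ((of_nat m + 1) ^ 2 - of_nat K ^ 2)
       * ((-1) ^ K * of_nat (Suc m choose K) * of_nat (m + K choose K) :: rat)"
proof (induction K)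
  case (Suc K)
  define t where "t k = ((-1) ^ k * of_nat (Suc m choose k) * of_nat (m + k choose k) :: rat)" for k
  have "t (Suc K) * (of_nat K + 1) ^ 2
      = - ((-1) ^ K) * (of_nat (Suc m choose Suc K) * (of_nat K + 1))
          * (of_nat (Suc (m + K) choose Suc K) * (of_nat K + 1))"
    by (simp add: t_def power2_eq_square mult_ac del: binomial_Suc_Suc)
  also have "\<dots> = - (((of_nat m + 1) ^ 2 - of_nat K ^ 2) * t K)"
    unfolding binomial_absorption_rat[of "m + K"] binomial_absorb_comp_rat[of "Suc m"] t_def
    by (simp add: power2_eq_square algebra_simps del: binomial_Suc_Suc)
  finally show ?case
    using Suc.IH unfolding t_def[symmetric] sum.atMost_Suc of_nat_Suc by (simp add: algebra_simps)
qed simp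

text \<open>The sum is the integral of P_m(1 - 2x^4) over [0,1]. With M = m + 1, the identity
  (4M+1)(M+k) - (4M-1)(M-k) = 2M(4k+1) cancels the denominator 4k+1, and what is left is an
  alternating sum equal to zero. This gives a first-order recurrence in m.\<close>

lemma sum_legendre_coeff_over_linear:
  "(\<Sum>k\<le>m. legendre_coeff m k / (4 * of_nat k + 1)) * (\<Prod>j\<le>m. 4 * of_nat j + 1)
     = (\<Prod>j=1..m. 4 * of_nat j - 1)"
proof (induction m)
  case (Suc m)
  let ?M = "of_nat m + 1 :: rat"
  define t where "t k = ((-1) ^ k * of_nat (Suc m choose k) * of_nat (m + k choose k) :: rat)" for k
  \<comment> \<open>Both degrees share the range up to m + 1; for degree m the extra term is
    zero.\<close>
  define S where "S n = (\<Sum>k\<le>Suc m. legendre_coeff n k / (4 * of_nat k + 1))" for n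
  have M: "?M \<noteq> 0"
    by (metis of_nat_Suc of_nat_neq_0 add.commute)
  have t0: "(\<Sum>k\<le>Suc m. t k) = 0"
    using sum_alternating_binomial_product[of m "Suc m"] M
    unfolding t_def[symmetric] by (simp add: add.commute)
  have "(4 * ?M + 1) * (legendre_coeff (Suc m) k / (4 * of_nat k + 1))
      - (4 * ?M - 1) * (legendre_coeff m k / (4 * of_nat k + 1)) = 2 * t k" for k
  proof -
    have k: "(4 * of_nat k + 1 :: rat) \<noteq> 0"
      by (metis of_nat_Suc of_nat_mult of_nat_neq_0 of_nat_numeral add.commute)
    note l = legendre_coeff_Suc_left[where m = m and k = k, folded t_def]
    have "((4 * ?M + 1) * legendre_coeff (Suc m) k - (4 * ?M - 1) * legendre_coeff m k) * ?M
        = (4 * ?M + 1) * (legendre_coeff (Suc m) k * ?M) - (4 * ?M - 1) * (legendre_coeff m k * ?M)"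
      by (simp only: left_diff_distrib mult.assoc)
    also have "\<dots> = 2 * t k * (4 * of_nat k + 1) * ?M"
      unfolding l by algebra
    finally have "(4 * ?M + 1) * legendre_coeff (Suc m) k - (4 * ?M - 1) * legendre_coeff m k
        = 2 * t k * (4 * of_nat k + 1)"
      using M by simp
    then have "((4 * ?M + 1) * legendre_coeff (Suc m) k - (4 * ?M - 1) * legendre_coeff m k)
        / (4 * of_nat k + 1) = 2 * t k"
      using k M by simp
    then show ?thesis by (simp only: diff_divide_distrib times_divide_eq_right)
  qed
  then have "(4 * ?M + 1) * S (Suc m) - (4 * ?M - 1) * S m = 2 * (\<Sum>k\<le>Suc m. t k)"
    unfolding S_def sum_distrib_left sum_subtractf[symmetric] by (intro sum.cong refl)
  then have rec: "(4 * ?M + 1) * S (Suc m) = (4 * ?M - 1) * S m"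
    using t0 by simp
  moreover have "S m = (\<Sum>k\<le>m. legendre_coeff m k / (4 * of_nat k + 1))"
    unfolding S_def by (simp add: legendre_coeff_def)
  ultimately have IH: "S m * (\<Prod>j\<le>m. 4 * of_nat j + 1) = (\<Prod>j=1..m. 4 * of_nat j - 1)"
    using Suc.IH by simp
  have "S (Suc m) * (\<Prod>j\<le>Suc m. 4 * of_nat j + 1)
      = (4 * ?M + 1) * S (Suc m) * (\<Prod>j\<le>m. 4 * of_nat j + 1)"
    by (simp only: prod.atMost_Suc of_nat_Suc mult_ac add.commute)
  also have "\<dots> = (4 * ?M - 1) * (\<Prod>j=1..m. 4 * of_nat j - 1)"
    unfolding rec IH[symmetric] by (rule mult.assoc)
  also have "\<dots> = (\<Prod>j=1..Suc m. 4 * of_nat j - 1)"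
    by (simp add: add.commute mult.commute)
  finally show ?case unfolding S_def .
qed simp

subsection \<open>Congruences in \<open>\<int>\<^sub>p\<close>\<close>

text \<open>Frees later arguments from lowest terms: if a/b = n/d with n/d reduced, then n b = a d,
  so p dividing d would also divide n, against coprimality.\<close>

lemma p_integral_iff:
  assumes "prime p"
  shows "x \<in> p_integral p \<longleftrightarrow> (\<exists>a b. \<not> int p dvd b \<and> x = of_int a / of_int b)"
proof
  assume "x \<in> p_integral p"
  moreover obtain n d where "quotient_of x = (n, d)" by fastforce
  ultimately show "\<exists>a b. \<not> int p dvd b \<and> x = of_int a / of_int b"
    by (auto simp: p_integral_def dest: quotient_of_div)
next
  assume "\<exists>a b. \<not> int p dvd b \<and> x = of_int a / of_int b"
  then obtain a b where b: "\<not> int p dvd b" and x: "x = of_int a / of_int b" by blast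
  obtain n d where q: "quotient_of x = (n, d)" by fastforce
  have "b \<noteq> 0" using b by auto
  have "d > 0" "coprime n d" "x = of_int n / of_int d"
    using q quotient_of_denom_pos quotient_of_coprime quotient_of_div by blast+
  then have "of_int (n * b) = (of_int (a * d) :: rat)"
    using x \<open>b \<noteq> 0\<close> by (simp add: field_simps)
  then have nb: "n * b = a * d" by (simp only: of_int_eq_iff)
  have "\<not> int p dvd d"
  proof
    assume d: "int p dvd d"
    then have "int p dvd n * b" by (simp add: nb)
    then have "int p dvd n"
      using assms b by (simp add: prime_dvd_mult_iff)
    with d \<open>coprime n d\<close> assms show False
      by (meson coprime_common_divisor not_prime_unit prime_nat_int_transfer)
  qed
  then show "x \<in> p_integral p" by (simp add: p_integral_def q)
qed

lemma p_integral_of_int [simp]: "prime p \<Longrightarrow> of_int a \<in> p_integral p"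
  using p_integral_iff[of p "of_int a"]
  by (metis div_by_1 not_prime_unit of_int_1 prime_nat_int_transfer)

lemma p_integral_add:
  assumes "prime p" "x \<in> p_integral p" "y \<in> p_integral p"
  shows "x + y \<in> p_integral p"
proof -
  obtain a b c d where ab: "\<not> int p dvd b" "x = of_int a / of_int b"
    and cd: "\<not> int p dvd d" "y = of_int c / of_int d"
    using assms p_integral_iff by metis
  then have "b \<noteq> 0" "d \<noteq> 0" by auto
  with ab cd have "x + y = of_int (a * d + c * b) / of_int (b * d)"
    by (simp add: add_frac_eq)
  moreover have "\<not> int p dvd b * d"
    using ab cd assms(1) by (simp add: prime_dvd_mult_iff)
  ultimately show ?thesis using p_integral_iff[OF assms(1)] by blast
qed

lemma p_integral_mult:
  assumes "prime p" "x \<in> p_integral p" "y \<in> p_integral p"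
  shows "x * y \<in> p_integral p"
proof -
  obtain a b c d where ab: "\<not> int p dvd b" "x = of_int a / of_int b"
    and cd: "\<not> int p dvd d" "y = of_int c / of_int d"
    using assms p_integral_iff by metis
  then have "x * y = of_int (a * c) / of_int (b * d)" by simp
  moreover have "\<not> int p dvd b * d"
    using ab cd assms(1) by (simp add: prime_dvd_mult_iff)
  ultimately show ?thesis using p_integral_iff[OF assms(1)] by blast
qed

lemma p_integral_of_nat [simp]: "prime p \<Longrightarrow> of_nat a \<in> p_integral p"
  using p_integral_of_int[of p "int a"] by simp

lemma p_integral_minus: "prime p \<Longrightarrow> x \<in> p_integral p \<Longrightarrow> - x \<in> p_integral p"
  using p_integral_mult[of p "of_int (-1)" x] p_integral_of_int[of p "-1"] by simp

lemma p_integral_cong_iff: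
  assumes "prime p"
  shows "p_integral_cong p a b m \<longleftrightarrow>
    b \<in> p_integral p \<and> (\<exists>c\<in>p_integral p. a = b + of_nat m * c)"
  unfolding p_integral_cong_def
  using p_integral_add[OF assms] p_integral_mult[OF assms] p_integral_of_nat[OF assms]
  by (metis add_diff_cancel_left' diff_add_cancel add.commute)

lemma p_integral_cong_refl:
  "prime p \<Longrightarrow> a \<in> p_integral p \<Longrightarrow> p_integral_cong p a a m"
  using p_integral_of_int[of p 0] by (auto simp: p_integral_cong_def intro!: bexI[of _ 0])

lemma p_integral_cong_sym:
  assumes "prime p" "p_integral_cong p a b m"
  shows "p_integral_cong p b a m"
proof -
  obtain c where "c \<in> p_integral p" "a - b = of_nat m * c"
    using assms(2) by (auto simp: p_integral_cong_def)
  then have "b - a = of_nat m * (- c)" "- c \<in> p_integral p"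
    using p_integral_minus[OF assms(1)] by (auto simp: algebra_simps)
  then show ?thesis using assms(2) unfolding p_integral_cong_def by blast
qed

lemma p_integral_cong_add:
  assumes "prime p" "p_integral_cong p a b m" "p_integral_cong p c d m"
  shows "p_integral_cong p (a + c) (b + d) m"
proof -
  obtain x y where "x \<in> p_integral p" "a = b + of_nat m * x"
    "y \<in> p_integral p" "c = d + of_nat m * y"
    using assms p_integral_cong_iff by metis
  then have "a + c = b + d + of_nat m * (x + y)" "x + y \<in> p_integral p"
    using p_integral_add[OF assms(1)] by (auto simp: algebra_simps)
  then show ?thesis
    using assms p_integral_cong_iff p_integral_add by metis
qed

lemma p_integral_cong_trans:
  assumes "prime p" "p_integral_cong p a b m" "p_integral_cong p b c m"
  shows "p_integral_cong p a c m"
proof -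
  obtain x y where "x \<in> p_integral p" "a = b + of_nat m * x"
    "y \<in> p_integral p" "b = c + of_nat m * y"
    using assms p_integral_cong_iff by metis
  then have "a = c + of_nat m * (y + x)" "y + x \<in> p_integral p"
    using p_integral_add[OF assms(1)] by (auto simp: algebra_simps)
  then show ?thesis
    using assms p_integral_cong_iff by metis
qed

lemma p_integral_cong_mult:
  assumes "prime p" "p_integral_cong p a b m" "p_integral_cong p c d m"
  shows "p_integral_cong p (a * c) (b * d) m"
proof -
  obtain x y where xy: "x \<in> p_integral p" "a = b + of_nat m * x"
    "y \<in> p_integral p" "c = d + of_nat m * y"
    using assms p_integral_cong_iff by metis
  have bd: "b \<in> p_integral p" "c \<in> p_integral p" "d \<in> p_integral p"
    using assms by (auto simp: p_integral_cong_def)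
  have "a * c = b * d + of_nat m * (b * y + x * c)"
    unfolding xy by (simp add: algebra_simps)
  moreover have "b * y + x * c \<in> p_integral p"
    using xy bd p_integral_add[OF assms(1)] p_integral_mult[OF assms(1)] by blast
  ultimately show ?thesis
    using assms bd p_integral_cong_iff p_integral_mult by metis
qed

text \<open>Since every summand carries an explicit factor p, this reduces the work modulo
  \<open>p ^ 2\<close> to congruences modulo p.\<close>

lemma p_integral_cong_scale:
  assumes "prime p" "p_integral_cong p a b p"
  shows "p_integral_cong p (of_nat p * a) (of_nat p * b) (p ^ 2)"
proof -
  obtain x where "x \<in> p_integral p" "a = b + of_nat p * x"
    using assms p_integral_cong_iff by metis
  then have "of_nat p * a = of_nat p * b + of_nat (p ^ 2) * x"
    by (simp add: algebra_simps power2_eq_square)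
  moreover have "of_nat p * b \<in> p_integral p"
    using assms by (simp add: p_integral_cong_def p_integral_mult)
  ultimately show ?thesis
    using assms \<open>x \<in> p_integral p\<close> p_integral_cong_iff by metis
qed

lemma p_integral_cong_sum:
  assumes "prime p" "\<And>k. k \<in> A \<Longrightarrow> p_integral_cong p (f k) (g k) m"
  shows "p_integral_cong p (sum f A) (sum g A) m"
  using assms(2)
  by (induction A rule: infinite_finite_induct)
    (use assms(1) p_integral_cong_refl[of p 0 m] p_integral_of_int[of p 0] in
      \<open>auto intro: p_integral_cong_add\<close>)

lemma p_integral_cong_divide:
  assumes "prime p" "[a = b] (mod int m)" "\<not> int p dvd d"
  shows "p_integral_cong p (of_int a / of_int d) (of_int b / of_int d) m"
proof -
  obtain c where "a = b + int m * c"
    using assms(2) by (metis cong_iff_lin cong_sym)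
  then have "of_int a / of_int d = of_int b / of_int d + of_nat m * (of_int c / of_int d :: rat)"
    by (simp add: add_divide_distrib)
  then show ?thesis
    using assms p_integral_cong_iff p_integral_iff by metis
qed

subsection \<open>Reduction modulo \<open>p\<^sup>2\<close>\<close>

text \<open>The product of the consecutive integers from p - l to p + k with the factor p left out.
  Over the integers no difference truncates, and for l \<ge> p > 0 the factor i = p makes it zero,
  like the binomial it describes.\<close>

definition shifted_product :: "nat \<Rightarrow> nat \<Rightarrow> nat \<Rightarrow> int" where
  "shifted_product p k l = (\<Prod>i=1..k. int p + int i) * (\<Prod>i=1..l. int p - int i)"

lemma binomial_eq_shifted_product:
  "of_nat (p + k choose (k + l + 1)) * fact (k + l + 1)
     = (of_nat p * of_int (shifted_product p k l) :: rat)"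
proof (induction k)
  case 0
  show ?case
  proof (induction l)
    case (Suc l)
    have "of_nat (p choose Suc (l + 1)) * fact (Suc (l + 1))
        = of_nat (p choose Suc (l + 1)) * (of_nat (l + 1) + 1) * (fact (l + 1) :: rat)"
      by (simp only: fact_Suc of_nat_Suc mult_ac add.commute)
    also have "\<dots> = (of_nat p - of_nat (l + 1)) * (of_nat (p + 0 choose (0 + l + 1)) * fact (0 + l + 1))"
      unfolding binomial_absorb_comp_rat by simp
    also have "\<dots> = of_nat p * of_int (shifted_product p 0 (Suc l))"
      unfolding Suc.IH by (simp add: shifted_product_def algebra_simps)
    finally show ?case by (simp only: add_Suc_right add_Suc add_0 add_0_right plus_1_eq_Suc)
  qed (simp add: shifted_product_def)
next
  case (Suc k)
  have "of_nat (Suc (p + k) choose Suc (k + l + 1)) * fact (Suc (k + l + 1))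
      = of_nat (Suc (p + k) choose Suc (k + l + 1)) * (of_nat (k + l + 1) + 1) * (fact (k + l + 1) :: rat)"
    by (simp only: fact_Suc of_nat_Suc mult_ac add.commute)
  also have "\<dots> = (of_nat (p + k) + 1) * (of_nat (p + k choose (k + l + 1)) * fact (k + l + 1))"
    unfolding binomial_absorption_rat by (rule mult.assoc)
  also have "\<dots> = of_nat p * of_int (shifted_product p (Suc k) l)"
    unfolding Suc.IH by (simp add: shifted_product_def algebra_simps)
  finally show ?case by (simp only: add_Suc_right add_Suc)
qed

lemma shifted_product_cong:
  "[shifted_product p k l = (-1) ^ l * fact k * fact l] (mod int p)"
proof -
  have "[(\<Prod>i=1..k. int p + int i) = (\<Prod>i=1..k. int i)] (mod int p)"
    by (intro cong_prod) (simp add: cong_def)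
  moreover have "[(\<Prod>i=1..l. int p - int i) = (\<Prod>i=1..l. - int i)] (mod int p)"
    by (intro cong_prod) (simp add: cong_iff_dvd_diff)
  moreover have "(\<Prod>i=1..n. int i) = fact n" for n
    by (simp add: fact_prod)
  moreover have "(\<Prod>i=1..l. - int i) = (-1) ^ l * (\<Prod>i=1..l. int i)"
    using prod.distrib[of "\<lambda>_. - 1" int "{1..l}"] by simp
  ultimately show ?thesis
    unfolding shifted_product_def by (metis cong_mult mult.assoc mult.commute)
qed

text \<open>The (4k)! of the weight cancels against (4k+1)!, isolating 4k+1, the only part of the
  denominator that p can divide when 3 < p is prime and k < p.\<close>

lemma quartic_weight_times_binomial:
  assumes "i + l = 4 * k"
  shows "quartic_weight k * of_nat (p + i choose (4 * k + 1))
     = of_nat p * of_int (shifted_product p i l)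
         / of_int ((4 * int k + 1) * (fact k ^ 4 * (-27) ^ k))"
proof -
  let ?B = "of_nat (p + i choose (4 * k + 1)) :: rat" and ?c = "4 * of_nat k + 1 :: rat"
  have "?c \<noteq> 0"
    by (metis of_nat_Suc of_nat_mult of_nat_neq_0 of_nat_numeral add.commute)
  then have "quartic_weight k * ?B = ?B * (?c * fact (4 * k)) / (?c * (fact k ^ 4 * (-27) ^ k))"
    by (simp add: quartic_weight_def)
  also have "?c * fact (4 * k) = fact (4 * k + 1)"
    by (simp add: add.commute)
  also have "?B * fact (4 * k + 1) = of_nat p * of_int (shifted_product p i l)"
    using binomial_eq_shifted_product[of p i l] assms by simp
  finally show ?thesis by simp
qed

text \<open>Both sides start at 1, and their term ratios (3k+1)(3k+2) / (9(k+1)^2) and -(m-k)(m+k+1)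
  / (k+1)^2 agree modulo p. The denominators are units because k + 1 < p and p > 3.\<close>

lemma legendre_coeff_cong:
  assumes p: "prime p" "p > 3" and k: "k \<le> p div 3"
  shows "p_integral_cong p (fact (3 * k) / (fact k ^ 3 * 27 ^ k)) (legendre_coeff (p div 3) k) p"
  using k
proof (induction k)
  case 0
  show ?case
    using p_integral_cong_refl[of p 1 p] p_integral_of_int[of p 1] p by simp
next
  case (Suc k)
  define m where "m = p div 3"
  define d where "d = 9 * (int k + 1) ^ 2"
  have k: "Suc k < p" using Suc.prems p by linarith
  have "\<not> int p dvd int (Suc k)"
    using k by (auto dest: zdvd_imp_le)
  moreover have "\<not> int p dvd 3"
    using p by (auto dest: zdvd_imp_le)
  moreover have "d = 3 * 3 * (int (Suc k)) ^ 2" by (simp add: d_def add.commute)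
  ultimately have d: "\<not> int p dvd d"
    using p(1) by (metis prime_dvd_mult_iff prime_dvd_power prime_nat_int_transfer)
  have "\<not> 3 dvd p"
    using p by (auto simp: prime_nat_iff)
  then have "p = 3 * m + 1 \<or> p = 3 * m + 2"
    unfolding m_def by presburger
  then consider "int p = 3 * int m + 1" | "int p = 3 * int m + 2"
    by fastforce
  \<comment> \<open>The difference of the two sides is (3m+1)(3m+2), independent of k, and one of
    these factors is p.\<close>
  then have c: "[(3 * int k + 1) * (3 * int k + 2)
      = - 9 * (int m - int k) * (int m + int k + 1)] (mod int p)"
  proof cases
    case 1
    have "(3 * int k + 1) * (3 * int k + 2) - - 9 * (int m - int k) * (int m + int k + 1)
        = int p * (int p + 1)"
      unfolding 1 by (simp add: algebra_simps)
    then show ?thesis unfolding cong_iff_dvd_diff by simp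
  next
    case 2
    have "(3 * int k + 1) * (3 * int k + 2) - - 9 * (int m - int k) * (int m + int k + 1)
        = int p * (int p - 1)"
      unfolding 2 by (simp add: algebra_simps)
    then show ?thesis unfolding cong_iff_dvd_diff by simp
  qed
  have nz: "of_nat k + 1 \<noteq> (0 :: rat)"
    by (metis of_nat_Suc of_nat_neq_0 add.commute)
  have scale: "a * (3 * z) * f / ((z * g) ^ 3 * 27 ^ Suc k) = f / (g ^ 3 * 27 ^ k) * (a / (9 * z ^ 2))"
    if "z \<noteq> 0" "g \<noteq> 0" for a f g z :: rat
    using that by (simp add: field_simps power2_eq_square power3_eq_cube)
  have "fact (3 * Suc k) = ((3 * of_nat k + 1) * (3 * of_nat k + 2) * (3 * (of_nat k + 1)) * fact (3 * k) :: rat)"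
    by (simp add: fact_reduce numeral_eq_Suc algebra_simps)
  moreover have "fact (Suc k) = (of_nat k + 1) * (fact k :: rat)"
    by (simp add: algebra_simps)
  ultimately have "fact (3 * Suc k) / (fact (Suc k) ^ 3 * 27 ^ Suc k)
      = fact (3 * k) / (fact k ^ 3 * 27 ^ k) * (of_int ((3 * int k + 1) * (3 * int k + 2)) / of_int d :: rat)"
    using scale[OF nz, of "fact k"] by (simp add: d_def del: fact_Suc)
  moreover have "legendre_coeff m (Suc k) = legendre_coeff m k
      * (of_int (- 9 * (int m - int k) * (int m + int k + 1)) / of_int d)"
  proof -
    let ?e = "- (of_nat m - of_nat k) * (of_nat m + of_nat k + 1) :: rat"
    have "legendre_coeff m (Suc k) = ?e * legendre_coeff m k / (of_nat k + 1) ^ 2"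
      using legendre_coeff_Suc_right[of m k] nz by (simp add: eq_divide_eq)
    also have "\<dots> = legendre_coeff m k * ((9 * ?e) / (9 * (of_nat k + 1) ^ 2))"
      by simp
    also have "9 * ?e = of_int (- 9 * (int m - int k) * (int m + int k + 1))"
      by (simp add: algebra_simps)
    also have "9 * (of_nat k + 1) ^ 2 = (of_int d :: rat)"
      by (simp add: d_def)
    finally show ?thesis .
  qed
  ultimately show ?case
    using p_integral_cong_mult[OF p(1) Suc.IH p_integral_cong_divide[OF p(1) c d]] Suc.prems
    unfolding m_def by simp
qed

lemma legendre_sum_cong_0:
  assumes p: "prime p" "p > 3" and mod4: "p mod 4 = 3"
  shows "p_integral_cong p (\<Sum>k\<le>p div 3. legendre_coeff (p div 3) k / (4 * of_nat k + 1)) 0 p"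
proof -
  let ?m = "p div 3"
  define N where "N = (\<Prod>j=1..?m. 4 * int j - 1)"
  define D where "D = (\<Prod>j\<le>?m. 4 * int j + 1)"
  have "\<not> int p dvd 4 * int j + 1" if "j \<le> ?m" for j
  proof
    assume "int p dvd 4 * int j + 1"
    then have "int p dvd int (4 * j + 1)" by (simp add: add.commute)
    then have "p dvd 4 * j + 1" by (simp only: int_dvd_int_iff)
    then obtain q where q: "4 * j + 1 = p * q" by blast
    \<comment> \<open>The only multiple of p left for 4j + 1 is p itself, which the residue of p
      modulo 4 excludes.\<close>
    have "4 * j + 1 < p * 2" using that p by linarith
    then have "q < 2" unfolding q by simp
    with q have "4 * j + 1 = p" by (cases "q = 0") (auto simp: less_2_cases_iff)
    with mod4 show False by presburger
  qed
  then have D: "\<not> int p dvd D"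
    using p unfolding D_def by (subst prime_dvd_prod_iff) auto
  define q where "q = p div 4"
  have q: "p = 4 * q + 3" unfolding q_def using mod4 by presburger
  have "3 * (q + 1) \<le> p" unfolding q using q p(2) by simp
  \<comment> \<open>The factor with index q + 1 = (p+1)/4 is p itself; it occurs because 3(q+1)
    \<le> 4q + 3 = p.\<close>
  then have "q + 1 \<in> {1..?m}" by (simp add: less_eq_div_iff_mult_less_eq mult.commute)
  then have "4 * int (q + 1) - 1 dvd N"
    unfolding N_def by (intro dvd_prodI[where f = "\<lambda>j. 4 * int j - 1"]) auto
  also have "4 * int (q + 1) - 1 = int p" using q by simp
  finally have "int p dvd N" .
  then have "[N = 0] (mod int p)" by (simp add: cong_0_iff)
  then have "p_integral_cong p (of_int N / of_int D) (of_int 0 / of_int D) p"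
    using p D by (intro p_integral_cong_divide)
  moreover have "(\<Sum>k\<le>?m. legendre_coeff ?m k / (4 * of_nat k + 1)) = of_int N / of_int D"
    using sum_legendre_coeff_over_linear[of ?m] D by (auto simp: N_def D_def eq_divide_eq)
  ultimately show ?thesis by simp
qed

section \<open>The individual summands modulo the square of p\<close>

definition reduced_term :: "nat \<Rightarrow> rat" where
  "reduced_term k = fact (3 * k) / (fact k ^ 3 * 27 ^ k) / (4 * of_nat k + 1)"

text \<open>The size bound leaves the multiples p, 2p and 3p; p has the wrong residue modulo 4 and
  2p the wrong parity.\<close>

lemma four_k_plus_1_multiple:
  fixes p k :: nat
  assumes "p mod 4 = 3" "k < p" "p dvd 4 * k + 1"
  shows "4 * k + 1 = 3 * p"
proof -
  obtain q where q: "4 * k + 1 = p * q" using assms(3) by blast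
  have "p * q < p * 4" using q assms(2) by linarith
  then have "q < 4" by simp
  then consider "q = 0" | "q = 1" | "q = 2" | "q = 3" by linarith
  then show ?thesis
  proof cases
    case 2
    then have "4 * k + 1 = p" using q by simp
    with assms(1) show ?thesis by presburger
  next
    case 3
    then have "4 * k + 1 = 2 * p" using q by simp
    then show ?thesis by presburger
  qed (use q in simp_all)
qed

lemma not_dvd_fact_pow:
  assumes "prime p" "p > 3" "k < p"
  shows "\<not> int p dvd fact k ^ 4 * (-27) ^ k"
proof
  assume "int p dvd fact k ^ 4 * (-27) ^ k"
  then have "int p dvd fact k \<or> int p dvd - 27"
    using assms(1) by (metis prime_dvd_mult_iff prime_dvd_power prime_nat_int_transfer)
  moreover have "\<not> int p dvd fact k"
    using assms prime_dvd_fact_iff[of p k] int_dvd_int_iff[of p "fact k"] by simp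
  moreover have "int p dvd 3 ^ 3 \<Longrightarrow> int p dvd 3"
    using assms(1) by (metis prime_dvd_power prime_nat_int_transfer)
  moreover have "\<not> int p dvd 3"
    using assms(2) by (auto dest: zdvd_imp_le)
  ultimately show False by simp
qed

text \<open>For 3k < p the number 4k+1 is prime to p, so \<open>shifted_product\<close> may be
  reduced modulo p. The outcome is the same for i = k and i = 3k, since it is symmetric in i and l
  up to a sign.\<close>

lemma quartic_weight_times_binomial_cong:
  assumes p: "prime p" "p > 3" "p mod 4 = 3" and k: "3 * k < p" and i: "i + l = 4 * k" "i = k \<or> i = 3 * k"
  shows "p_integral_cong p (quartic_weight k * of_nat (p + i choose (4 * k + 1)))
           (of_nat p * reduced_term k) (p ^ 2)"
proof -
  define d where "d = (4 * int k + 1) * (fact k ^ 4 * (-27) ^ k)"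
  have "\<not> p dvd 4 * k + 1"
    using four_k_plus_1_multiple[of p k] p(3) k by linarith
  then have "\<not> int p dvd int (4 * k + 1)" by (simp only: int_dvd_int_iff not_False_eq_True)
  then have "\<not> int p dvd 4 * int k + 1" by (simp add: add.commute)
  then have d: "\<not> int p dvd d"
    using p k not_dvd_fact_pow[of p k] unfolding d_def by (simp add: prime_dvd_mult_iff)
  \<comment> \<open>As l is k or 3k, its parity is that of k, so this sign cancels the one in
    \<open>(-27) ^ k\<close>.\<close>
  have l: "(-1 :: int) ^ l = (-1) ^ k" "fact i * fact l = fact k * (fact (3 * k) :: int)"
    using i by (auto simp: power_mult)
  have "(-27 :: rat) ^ k = (-1) ^ k * 27 ^ k"
    by (simp flip: power_mult_distrib)
  then have "of_int ((-1) ^ l * fact i * fact l) / of_int d = reduced_term k"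
    unfolding mult.assoc l d_def reduced_term_def
    by (simp add: power4_eq_xxxx power3_eq_cube)
  then have "p_integral_cong p (of_int (shifted_product p i l) / of_int d) (reduced_term k) p"
    using p_integral_cong_divide[OF p(1) shifted_product_cong[of p i l] d] by simp
  from p_integral_cong_scale[OF p(1) this] show ?thesis
    unfolding quartic_weight_times_binomial[OF i(1)] d_def[symmetric] by simp
qed

lemma sum_lessThan_truncate:
  fixes f :: "nat \<Rightarrow> 'a :: comm_monoid_add"
  assumes "p > 0"
  shows "(\<Sum>k<p. if k \<le> p div 3 then f k else 0) = (\<Sum>k\<le>p div 3. f k)"
proof -
  have "{..p div 3} \<subseteq> {..<p}" using assms by auto
  then show ?thesis
    by (intro sum.mono_neutral_cong_right) auto
qed

lemma sum_reduced_term_cong_0: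
  assumes p: "prime p" "p > 3" "p mod 4 = 3"
  shows "p_integral_cong p (\<Sum>k\<le>p div 3. of_nat p * reduced_term k) 0 (p ^ 2)"
proof -
  let ?m = "p div 3"
  have "p_integral_cong p (reduced_term k) (legendre_coeff ?m k / (4 * of_nat k + 1)) p"
    if "k \<le> ?m" for k
  proof -
    have "\<not> p dvd 4 * k + 1"
      using four_k_plus_1_multiple[of p k] p that by linarith
    then have "\<not> int p dvd int (4 * k + 1)" by (simp only: int_dvd_int_iff not_False_eq_True)
    then have "1 / of_int (int (4 * k + 1)) \<in> p_integral p"
      using p_integral_iff[OF p(1)] by (metis of_int_1)
    then have "p_integral_cong p (1 / of_int (int (4 * k + 1))) (1 / of_int (int (4 * k + 1))) p"
      by (rule p_integral_cong_refl[OF p(1)])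
    from p_integral_cong_mult[OF p(1) legendre_coeff_cong[OF p(1,2) that] this]
    show ?thesis by (simp add: reduced_term_def add.commute)
  qed
  then have "p_integral_cong p (\<Sum>k\<le>?m. reduced_term k)
      (\<Sum>k\<le>?m. legendre_coeff ?m k / (4 * of_nat k + 1)) p"
    by (intro p_integral_cong_sum p) simp
  with legendre_sum_cong_0[OF p] have "p_integral_cong p (\<Sum>k\<le>?m. reduced_term k) 0 p"
    using p_integral_cong_trans[OF p(1)] by blast
  from p_integral_cong_scale[OF p(1) this] show ?thesis
    by (simp add: sum_distrib_left)
qed

text \<open>In this range the binomial need not vanish, but the product of the p + i with i \<le> 3k
  contains 2p, a second factor p. In the exceptional case 4k+1 = 3p it also contains 3p, which makes
  up for the p lost in the denominator.\<close>

lemma quartic_weight_times_binomial_cong_0: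
  assumes p: "prime p" "p > 3" "p mod 4 = 3" and k: "p \<le> 3 * k" "k < p"
  shows "p_integral_cong p (quartic_weight k * of_nat (p + 3 * k choose (4 * k + 1))) 0 (p ^ 2)"
proof -
  define e :: int where "e = fact k ^ 4 * (-27) ^ k"
  define A where "A = shifted_product p (3 * k) k"
  have e: "\<not> int p dvd e"
    using not_dvd_fact_pow[OF p(1,2) k(2)] by (simp add: e_def)
  have "\<exists>a b. \<not> int p dvd b \<and>
      of_nat p * of_int A / of_int ((4 * int k + 1) * e) = (of_nat (p ^ 2) * (of_int a / of_int b) :: rat)"
  proof (cases "p dvd 4 * k + 1")
    case False
    then have "\<not> int p dvd int (4 * k + 1)" by (simp only: int_dvd_int_iff not_False_eq_True)
    then have "\<not> int p dvd 4 * int k + 1" by (simp add: add.commute)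
    then have b: "\<not> int p dvd (4 * int k + 1) * e"
      using p(1) e by (simp add: prime_dvd_mult_iff)
    \<comment> \<open>The factor with i = p, available because p \<le> 3k.\<close>
    have "int p + int p dvd (\<Prod>i=1..3 * k. int p + int i)"
      using k p by (intro dvd_prodI[where f = "\<lambda>i. int p + int i"]) auto
    then have "int p dvd A"
      unfolding A_def shifted_product_def by (metis dvd_mult2 dvd_trans dvd_triv_left mult_2_right)
    then obtain a where "A = int p * a" by blast
    then have "of_nat p * of_int A / of_int ((4 * int k + 1) * e)
        = (of_nat (p ^ 2) * (of_int a / of_int ((4 * int k + 1) * e)) :: rat)"
      by (simp add: power2_eq_square)
    with b show ?thesis by blast
  next
    case True
    then have k3: "4 * k + 1 = 3 * p"
      using four_k_plus_1_multiple p(3) k(2) by blast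
    \<comment> \<open>From 4k = 3p - 1, so both i = p and i = 2p occur; their factors multiply to
      6p^2.\<close>
    then have "2 * p \<le> 3 * k" using p(2) by linarith
    then have "(\<Prod>i\<in>{p, 2 * p}. int p + int i) dvd (\<Prod>i=1..3 * k. int p + int i)"
      using p(2) by (intro prod_dvd_prod_subset) auto
    moreover have "(\<Prod>i\<in>{p, 2 * p}. int p + int i) = int p * int p * 6"
      using p(2) by simp
    ultimately have "int p * int p dvd A"
      unfolding A_def shifted_product_def by (metis dvd_mult2 dvd_trans dvd_triv_left)
    then obtain a where a: "A = int p * int p * a" by blast
    have "int (4 * k + 1) = int (3 * p)" unfolding k3 ..
    then have "4 * int k + 1 = 3 * int p" by simp
    then have "of_nat p * of_int A / of_int ((4 * int k + 1) * e)
        = (of_nat (p ^ 2) * (of_int a / of_int (3 * e)) :: rat)"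
      using p(2) a by (simp add: power2_eq_square)
    moreover have "\<not> int p dvd 3"
      using p(2) by (auto dest: zdvd_imp_le)
    then have "\<not> int p dvd 3 * e"
      using p(1) e by (simp add: prime_dvd_mult_iff)
    ultimately show ?thesis by blast
  qed
  then obtain a b where b: "\<not> int p dvd b"
    and ab: "of_nat p * of_int A / of_int ((4 * int k + 1) * e) = (of_nat (p ^ 2) * (of_int a / of_int b) :: rat)"
    by blast
  have "quartic_weight k * of_nat (p + 3 * k choose (4 * k + 1)) = of_nat (p ^ 2) * (of_int a / of_int b)"
    using quartic_weight_times_binomial[of "3 * k" k k p] ab unfolding A_def e_def by simp
  moreover have "of_int a / of_int b \<in> p_integral p"
    using p_integral_iff[OF p(1)] b by blast
  ultimately show ?thesis
    using p(1) p_integral_of_int[of p 0] unfolding p_integral_cong_iff[OF p(1)]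
    by (metis add_0 of_int_0)
qed

theorem theorem5p2:
  fixes p :: nat
  assumes "prime p" and "p > 3" and "p mod 4 = 3"
  shows "p_integral_cong p
           (\<Sum>n = 0..p - 1. of_int (almkvist_zudilin n) / (-3) ^ n)
           (\<Sum>n = 0..p - 1. of_int (almkvist_zudilin n) / (-27) ^ n)
           (p ^ 2)
       \<and> p_integral_cong p
           (\<Sum>n = 0..p - 1. of_int (almkvist_zudilin n) / (-27) ^ n)
           0
           (p ^ 2)"
proof -
  have range: "{0..p - 1} = {..<p}" using assms(2) by auto
  let ?g = "\<lambda>k. if k \<le> p div 3 then of_nat p * reduced_term k else 0"
  \<comment> \<open>The inequality is strict because 3k = p is impossible for a prime p > 3.\<close>
  have le: "k \<le> p div 3 \<longleftrightarrow> 3 * k < p" for k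
  proof -
    have "\<not> 3 dvd p" using assms by (auto simp: prime_nat_iff)
    then show ?thesis by presburger
  qed
  have zero: "p_integral_cong p (sum ?g {..<p}) 0 (p ^ 2)"
    using sum_reduced_term_cong_0[OF assms] assms(2) by (simp add: sum_lessThan_truncate)
  have refl0: "p_integral_cong p 0 0 (p ^ 2)"
    using assms(1) p_integral_of_int[of p 0] by (simp add: p_integral_cong_refl)
  have "p_integral_cong p (\<Sum>k<p. quartic_weight k * of_nat (p + k choose (4 * k + 1)))
      (sum ?g {..<p}) (p ^ 2)"
  proof (rule p_integral_cong_sum[OF assms(1)])
    fix k
    show "p_integral_cong p (quartic_weight k * of_nat (p + k choose (4 * k + 1))) (?g k) (p ^ 2)"
    proof (cases "3 * k < p")
      case True
      then show ?thesis
        using quartic_weight_times_binomial_cong[OF assms, of k k "3 * k"] by (simp add: le)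
    next
      case False
      \<comment> \<open>In the first expansion the summands with 3k \<ge> p vanish exactly.\<close>
      then have "p + k < 4 * k + 1" by simp
      then show ?thesis
        using refl0 False by (simp add: le binomial_eq_0)
    qed
  qed
  then have 3: "p_integral_cong p (\<Sum>n = 0..p - 1. of_int (almkvist_zudilin n) / (-3) ^ n) 0 (p ^ 2)"
    unfolding almkvist_zudilin_conv_az_minus3 range sum_az_minus3
    by (rule p_integral_cong_trans[OF assms(1) _ zero])
  have "p_integral_cong p (\<Sum>k<p. quartic_weight k * of_nat (p + 3 * k choose (4 * k + 1)))
      (sum ?g {..<p}) (p ^ 2)"
  proof (rule p_integral_cong_sum[OF assms(1)])
    fix k assume "k \<in> {..<p}"
    then show "p_integral_cong p (quartic_weight k * of_nat (p + 3 * k choose (4 * k + 1))) (?g k) (p ^ 2)"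
      using quartic_weight_times_binomial_cong[OF assms, of k "3 * k" k]
        quartic_weight_times_binomial_cong_0[OF assms, of k]
      by (cases "3 * k < p") (simp_all add: le)
  qed
  then have 27: "p_integral_cong p (\<Sum>n = 0..p - 1. of_int (almkvist_zudilin n) / (-27) ^ n) 0 (p ^ 2)"
    unfolding almkvist_zudilin_conv_az_minus27 range sum_az_minus27
    by (rule p_integral_cong_trans[OF assms(1) _ zero])
  \<comment> \<open>The congruence between the two sums follows from both being congruent to
    0.\<close>
  from 3 27 show ?thesis
    using p_integral_cong_trans[OF assms(1) 3 p_integral_cong_sym[OF assms(1) 27]] by blast
qed

end
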